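(* Let $n\ge k\ge 2$ be integers. The number of set partitions of $[n]=\{1,\ldots,n\}$ into $k$ blocks such that, for every $1\le i\le n-1$, the elements $i$ and $i+1$ are in different blocks, and also $1$ and $n$ are in different blocks, is $B_{n-k,k}(-1)$, the box polynomial $B_{n-k,k}(x)$ evaluated at $x=-1$.
   Context: For non-negative integers $m,n$, the box polynomial is $$B_{m,n}(x)=\sum_{\lambda\subseteq m\times n}\ \prod_{i=1}^{m}(x+\lambda_i),$$ where the sum is over all integer sequences (partitions) $\lambda=(n\ge\lambda_1\ge\lambda_2\ge\cdots\ge\lambda_m\ge 0)$, i.e. partitions with $m$ non-negative parts, each at most $n$ (an empty product is $1$). The blocks of a set partition are non-empty. *)

theory Defs
  imports
    "HOL-Library.Disjoint_Sets"
    "HOL-Computational_Algebra.Polynomial"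
begin

text \<open>Trailing zero parts are kept, so every sequence has length exactly \<open>m\<close>.
  The part \<open>\<lambda>\<^sub>i\<close> is \<open>l ! (i - 1)\<close>.\<close>

definition box_partitions :: "nat \<Rightarrow> nat \<Rightarrow> nat list set" where
  "box_partitions m n = {l. length l = m \<and> sorted_wrt (\<ge>) l \<and> set l \<subseteq> {0..n}}"

definition box_poly :: "nat \<Rightarrow> nat \<Rightarrow> int poly" where
  "box_poly m n = (\<Sum>l\<in>box_partitions m n. \<Prod>i<m. [:int (l ! i), 1:])"

definition in_different_blocks :: "'a set set \<Rightarrow> 'a \<Rightarrow> 'a \<Rightarrow> bool" where
  "in_different_blocks P a b \<longleftrightarrow> \<not> (\<exists>X\<in>P. a \<in> X \<and> b \<in> X)"

end

theory Submission
  imports Defs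
begin

text \<open>Call a partition of \<open>[n]\<close> linear if \<open>i\<close> and \<open>i + 1\<close> are always separated, and cyclic
  if moreover \<open>1\<close> and \<open>n\<close> are separated. Deleting \<open>n\<close> from a linear partition gives
  \<open>L(n,k) = L(n-1,k-1) + (k-1) L(n-1,k)\<close>, because \<open>n\<close> may join any block but that of \<open>n - 1\<close>; the
  values \<open>B\<^bsub>n-k,k-1\<^esub>(0)\<close> satisfy the same recurrence, by splitting on whether the largest part is
  maximal. Deleting \<open>n\<close> from a linear partition in which \<open>1\<close> and \<open>n\<close> share a block
  leaves a cyclic partition of \<open>[n-1]\<close>, so \<open>L(n,k) = C(n,k) + C(n-1,k)\<close>. This determines \<open>C\<close>, and
  it matches \<open>B\<^bsub>m+1,k\<^esub>(x) = x B\<^bsub>m,k\<^esub>(x) + B\<^bsub>m+1,k-1\<^esub>(x+1)\<close> at \<open>x = -1\<close>.\<close>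

section \<open>Recurrences for box polynomials\<close>

lemma finite_box_partitions: "finite (box_partitions m n)"
proof (rule finite_subset)
  show "box_partitions m n \<subseteq> {l. set l \<subseteq> {0..n} \<and> length l = m}"
    by (auto simp: box_partitions_def)
qed (simp add: finite_lists_length_eq)

text \<open>The parts decrease, so the head decides: either it is \<open>Suc n\<close>, which leaves
  the tail unrestricted below that bound, or all parts are at most \<open>n\<close>.\<close>

lemma box_partitions_Suc_Suc:
  "box_partitions (Suc m) (Suc n) =
     (#) (Suc n) ` box_partitions m (Suc n) \<union> box_partitions (Suc m) n"
proof (intro set_eqI iffI)
  fix l assume l: "l \<in> box_partitions (Suc m) (Suc n)"
  then obtain a l' where "l = a # l'"
    by (cases l) (auto simp: box_partitions_def)
  with l show "l \<in> (#) (Suc n) ` box_partitions m (Suc n) \<union> box_partitions (Suc m) n"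
    by (cases "a = Suc n") (fastforce simp: box_partitions_def)+
qed (fastforce simp: box_partitions_def)

lemma poly_box_poly:
  "poly (box_poly m n) x = (\<Sum>l\<in>box_partitions m n. \<Prod>i<m. x + int (l ! i))"
  by (simp add: box_poly_def poly_sum poly_prod add.commute)

lemma poly_box_poly_0_left [simp]: "poly (box_poly 0 n) x = 1"
proof -
  have "box_partitions 0 n = {[]}"
    by (auto simp: box_partitions_def)
  then show ?thesis by (simp add: poly_box_poly)
qed

lemma poly_box_poly_0_right [simp]: "poly (box_poly m 0) x = x ^ m"
proof -
  have "box_partitions m 0 = {replicate m 0}"
  proof (intro set_eqI iffI)
    fix l assume "l \<in> box_partitions m 0"
    then show "l \<in> {replicate m 0}"
      by (auto simp: box_partitions_def intro!: replicate_eqI)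
  qed (auto simp: box_partitions_def sorted_wrt_iff_nth_less)
  then show ?thesis by (simp add: poly_box_poly)
qed

lemma poly_box_poly_Suc_Suc:
  "poly (box_poly (Suc m) (Suc n)) x =
     (x + int (Suc n)) * poly (box_poly m (Suc n)) x + poly (box_poly (Suc m) n) x"
proof -
  have disj: "(#) (Suc n) ` box_partitions m (Suc n) \<inter> box_partitions (Suc m) n = {}"
    by (auto simp: box_partitions_def)
  show ?thesis
    unfolding poly_box_poly box_partitions_Suc_Suc
    by (subst sum.union_disjoint[OF _ _ disj])
      (simp_all add: finite_box_partitions sum.reindex prod.lessThan_Suc_shift
        sum_distrib_left del: prod.lessThan_Suc of_nat_Suc)
qed

text \<open>Combinatorially this splits on whether the smallest part is zero, but it also follows formally
  from the splitting on the largest part.\<close>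

lemma poly_box_poly_Suc_Suc_shift:
  "poly (box_poly (Suc m) (Suc n)) x =
     x * poly (box_poly m (Suc n)) x + poly (box_poly (Suc m) n) (x + 1)"
\<comment> \<open>The outer induction is on \<open>n\<close>, with an inner induction on
  \<open>m\<close> in each case.\<close>
proof (induction n arbitrary: m)
  case 0
  show ?case
  proof (induction m)
    case (Suc m)
    have "poly (box_poly (Suc (Suc m)) (Suc 0)) x =
        (x + 1) * poly (box_poly (Suc m) (Suc 0)) x + x ^ Suc (Suc m)"
      by (simp add: poly_box_poly_Suc_Suc[of _ 0])
    also have "\<dots> = x * ((x + 1) * poly (box_poly m (Suc 0)) x + x ^ Suc m) + (x + 1) ^ Suc (Suc m)"
      unfolding Suc.IH by (simp add: algebra_simps)
    also have "(x + 1) * poly (box_poly m (Suc 0)) x + x ^ Suc m = poly (box_poly (Suc m) (Suc 0)) x"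
      by (simp add: poly_box_poly_Suc_Suc[of _ 0])
    finally show ?case by simp
  qed (simp add: poly_box_poly_Suc_Suc)
next
  case outer: (Suc n)
  show ?case
  proof (induction m)
    case 0
    show ?case
      using outer.IH[of 0] by (simp add: poly_box_poly_Suc_Suc algebra_simps)
  next
    case (Suc m)
    have "poly (box_poly (Suc (Suc m)) (Suc (Suc n))) x =
        (x + int (Suc (Suc n))) * poly (box_poly (Suc m) (Suc (Suc n))) x +
        poly (box_poly (Suc (Suc m)) (Suc n)) x"
      by (rule poly_box_poly_Suc_Suc)
    \<comment> \<open>After both induction hypotheses are inserted,
      \<open>x + int (Suc (Suc n)) = (x + 1) + int (Suc n)\<close> lets the terms regroup into two
      right-hand sides of the largest-part recurrence, one at \<open>x\<close> and one at
      \<open>x + 1\<close>.\<close>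
    also have "\<dots> =
        x * ((x + int (Suc (Suc n))) * poly (box_poly m (Suc (Suc n))) x +
             poly (box_poly (Suc m) (Suc n)) x) +
        ((x + 1 + int (Suc n)) * poly (box_poly (Suc m) (Suc n)) (x + 1) +
             poly (box_poly (Suc (Suc m)) n) (x + 1))"
      unfolding Suc.IH outer.IH[of "Suc m"] by (simp add: algebra_simps)
    also have "\<dots> = x * poly (box_poly (Suc m) (Suc (Suc n))) x +
        poly (box_poly (Suc (Suc m)) (Suc n)) (x + 1)"
      by (simp only: poly_box_poly_Suc_Suc)
    finally show ?case .
  qed
qed

section \<open>Adding a point to a set partition\<close>

definition join_block :: "'a \<Rightarrow> 'a set set \<Rightarrow> 'a set \<Rightarrow> 'a set set" where
  "join_block a P X = insert (insert a X) (P - {X})"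

text \<open>Subtracting \<open>{{}}\<close> discards the empty remnant of a block
  \<open>{a}\<close>.\<close>

definition delete_point :: "'a \<Rightarrow> 'a set set \<Rightarrow> 'a set set" where
  "delete_point a P = (\<lambda>X. X - {a}) ` P - {{}}"

context
  fixes a :: 'a and A :: "'a set"
  assumes a: "a \<notin> A"
begin

lemma notin_block: "partition_on A P \<Longrightarrow> X \<in> P \<Longrightarrow> a \<notin> X"
  using a by (auto simp: partition_on_def)

lemma partition_on_insert_singleton:
  "partition_on A P \<Longrightarrow> partition_on (insert a A) (insert {a} P)"
  using a by (auto simp: partition_on_def disjoint_def)

lemma partition_on_join_block:
  assumes P: "partition_on A P" and X: "X \<in> P"
  shows "partition_on (insert a A) (join_block a P X)"
proof (rule partition_onI)
  show "\<Union> (join_block a P X) = insert a A"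
    using P X by (auto simp: partition_on_def join_block_def)
  show "{} \<notin> join_block a P X"
    using P by (auto simp: partition_on_def join_block_def)
  show "disjnt Y Z" if "Y \<in> join_block a P X" "Z \<in> join_block a P X" "Y \<noteq> Z" for Y Z
    using that P X notin_block[OF P]
    unfolding partition_on_def disjoint_def join_block_def disjnt_def by blast
qed

lemma delete_point_insert_singleton:
  assumes P: "partition_on A P"
  shows "delete_point a (insert {a} P) = P"
proof -
  have "(\<lambda>X. X - {a}) ` P = P"
    using notin_block[OF P] by force
  then show ?thesis
    using P by (auto simp: delete_point_def partition_on_def)
qed

lemma delete_point_join_block:
  assumes P: "partition_on A P" and X: "X \<in> P"
  shows "delete_point a (join_block a P X) = P"
proof -
  have "(\<lambda>X. X - {a}) ` (P - {X}) = P - {X}"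
    using notin_block[OF P] by force
  then show ?thesis
    using P X notin_block[OF P X]
    by (auto simp: delete_point_def join_block_def partition_on_def)
qed

lemma partition_on_insert_cases:
  assumes P: "partition_on (insert a A) P"
  obtains Q where "partition_on A Q" "P = insert {a} Q"
  | Q X where "partition_on A Q" "X \<in> Q" "P = join_block a Q X"
proof -
  obtain Y where Y: "Y \<in> P" "a \<in> Y"
    using P by (auto simp: partition_on_def)
  have disj: "disjnt Y Z" if "Z \<in> P" "Z \<noteq> Y" for Z
    using P Y that by (auto simp: partition_on_def disjoint_def disjnt_def)
  have rest: "partition_on (insert a A - Y) (P - {Y})"
    using P Y disj by (fastforce simp: partition_on_def disjoint_def disjnt_def)
  show thesis
  proof (cases "Y = {a}")
    case True
    have "insert a A - Y = A"
      using True a by auto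
    with rest that(1)[of "P - {Y}"] True Y show thesis
      by auto
  next
    case False
    let ?X = "Y - {a}"
    \<comment> \<open>As a nonempty subset of \<open>Y\<close> other than \<open>Y\<close>,
      \<open>?X\<close> cannot be a block of \<open>P\<close>. Hence removing \<open>?X\<close> from
      \<open>insert ?X (P - {Y})\<close> gives back \<open>P - {Y}\<close>.\<close>
    have X: "?X \<noteq> {}" "?X \<notin> P"
      using False Y disj[of ?X] by (auto simp: disjnt_def)
    have "Y \<subseteq> insert a A"
      using P Y by (auto simp: partition_on_def)
    then have "partition_on A (insert ?X (P - {Y}))"
    proof (subst partition_on_insert)
      show "disjnt ?X (\<Union> (P - {Y}))"
        using disj by (auto simp: disjnt_def)
      have "A - ?X = insert a A - Y"
        using a Y(2) by auto
      then show "partition_on (A - ?X) (P - {Y}) \<and> ?X \<subseteq> A \<and> ?X \<noteq> {}"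
        using rest X(1) \<open>Y \<subseteq> insert a A\<close> by auto
    qed
    moreover have "P = join_block a (insert ?X (P - {Y})) ?X"
    proof -
      have "insert a ?X = Y" "insert ?X (P - {Y}) - {?X} = P - {Y}"
        using X(2) Y(2) by auto
      then show ?thesis
        using Y(1) by (auto simp: join_block_def)
    qed
    ultimately show thesis
      using that(2) by blast
  qed
qed

text \<open>The block through \<open>a\<close> is \<open>{a}\<close> on the left, but contains the
  nonempty set \<open>X\<close> as well on the right.\<close>

lemma insert_singleton_neq_join_block:
  assumes "partition_on A P" "partition_on A Q" "X \<in> Q"
  shows "insert {a} P \<noteq> join_block a Q X"
proof
  assume "insert {a} P = join_block a Q X"
  then have "insert a X \<in> insert {a} P"
    by (simp add: join_block_def)
  then have "{a} = insert a X"
    using notin_block[OF assms(1), of "insert a X"] by auto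
  then have "X = {}"
    using notin_block[OF assms(2,3)] by auto
  then show False
    using assms by (auto simp: partition_on_def)
qed

text \<open>The block through \<open>a\<close> determines \<open>X\<close>, and deleting
  \<open>a\<close> recovers the partition.\<close>

lemma join_block_inject:
  assumes "partition_on A P" "X \<in> P" "partition_on A Q" "Y \<in> Q"
  shows "join_block a P X = join_block a Q Y \<longleftrightarrow> P = Q \<and> X = Y"
proof
  assume eq: "join_block a P X = join_block a Q Y"
  then have "insert a X \<in> insert (insert a Y) (Q - {Y})"
    by (metis insertI1 join_block_def)
  then have "insert a X = insert a Y"
    using notin_block[OF assms(3), of "insert a X"] by auto
  then have "X = Y"
    using notin_block[OF assms(1,2)] notin_block[OF assms(3,4)] by (metis insert_ident)
  moreover have "P = Q"
    using eq delete_point_join_block assms by metis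
  ultimately show "P = Q \<and> X = Y" by simp
qed simp

lemma card_insert_singleton:
  assumes "finite A" "partition_on A P"
  shows "card (insert {a} P) = Suc (card P)"
  using notin_block[OF assms(2), of "{a}"] finite_elements[OF assms]
  by (intro card_insert_disjoint) auto

lemma card_join_block:
  assumes "finite A" "partition_on A P" "X \<in> P"
  shows "card (join_block a P X) = card P"
proof -
  have "finite P"
    using finite_elements[OF assms(1,2)] .
  have "insert a X \<notin> P - {X}"
    using notin_block[OF assms(2)] by blast
  then have "card (join_block a P X) = Suc (card (P - {X}))"
    using \<open>finite P\<close> unfolding join_block_def by (intro card_insert_disjoint) auto
  also have "\<dots> = card P"
    using \<open>finite P\<close> assms(3) by (rule card_Suc_Diff1)
  finally show ?thesis .
qed

lemma in_different_blocks_insert_singleton: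
  assumes "b \<in> A"
  shows "in_different_blocks (insert {a} P) b c \<longleftrightarrow> in_different_blocks P b c"
  using assms a by (auto simp: in_different_blocks_def)

lemma in_different_blocks_singleton_point:
  assumes "partition_on A P" "b \<in> A"
  shows "in_different_blocks (insert {a} P) b a"
  using assms a notin_block[OF assms(1)] by (auto simp: in_different_blocks_def)

lemma in_different_blocks_join_block:
  assumes "X \<in> P" "b \<in> A" "c \<in> A"
  shows "in_different_blocks (join_block a P X) b c \<longleftrightarrow> in_different_blocks P b c"
  using assms a by (auto simp: in_different_blocks_def join_block_def)

lemma in_different_blocks_join_block_point:
  assumes "partition_on A P" "X \<in> P" "b \<in> A"
  shows "in_different_blocks (join_block a P X) b a \<longleftrightarrow> b \<notin> X"
  using assms a notin_block[OF assms(1)] by (auto simp: in_different_blocks_def join_block_def)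

end

lemma partition_on_block_ex1:
  assumes "partition_on A P" "b \<in> A"
  shows "\<exists>!X. X \<in> P \<and> b \<in> X"
  using assms unfolding partition_on_def disjoint_def by blast

text \<open>With \<open>b = n\<close> this counts the blocks that the new point \<open>n + 1\<close>
  may join.\<close>

lemma card_blocks_avoiding:
  assumes "finite A" "partition_on A P" "b \<in> A"
  shows "card {X \<in> P. b \<notin> X} = card P - 1"
proof -
  obtain Y where "Y \<in> P" "\<And>X. X \<in> P \<Longrightarrow> b \<in> X \<longleftrightarrow> X = Y"
    using partition_on_block_ex1[OF assms(2,3)] by blast
  then have "{X \<in> P. b \<notin> X} = P - {Y}" by auto
  then show ?thesis
    using \<open>Y \<in> P\<close> by (simp add: card_Diff_singleton)
qed

section \<open>Linear and cyclic partitions\<close>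

definition linear_partitions :: "nat \<Rightarrow> nat \<Rightarrow> nat set set set" where
  "linear_partitions n k = {P. partition_on {1..n} P \<and> card P = k \<and>
     (\<forall>i\<in>{1..n - 1}. in_different_blocks P i (i + 1))}"

text \<open>For \<open>n = 1\<close> the two points coincide, so this set is empty.\<close>

definition cyclic_partitions :: "nat \<Rightarrow> nat \<Rightarrow> nat set set set" where
  "cyclic_partitions n k = {P \<in> linear_partitions n k. in_different_blocks P 1 n}"

lemma finite_linear_partitions: "finite (linear_partitions n k)"
  by (rule finite_subset[OF _ finitely_many_partition_on[of "{1..n}"]])
    (auto simp: linear_partitions_def)

lemma linear_partitions_partition_on:
  "P \<in> linear_partitions n k \<Longrightarrow> partition_on {1..n} P"
  by (simp add: linear_partitions_def)

section \<open>The recurrence for linear partitions\<close>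

lemma atLeastAtMost_Suc_insert: "{1..Suc n} = insert (Suc n) {1..n}"
  by auto

text \<open>Isolates the one adjacency condition that involves the new point. For
  \<open>n = 0\<close> the left side would be vacuous while the right side would demand
  \<open>R 0\<close>.\<close>

lemma Ball_less_Suc:
  assumes "1 \<le> n"
  shows "(\<forall>i\<in>{1..Suc n - 1}. R i) \<longleftrightarrow> (\<forall>i\<in>{1..n - 1}. R i) \<and> R n"
  using assms by (cases n) (auto simp: atLeastAtMostSuc_conv)

lemma insert_singleton_in_linear_partitions:
  assumes "1 \<le> n" "partition_on {1..n} P"
  shows "insert {Suc n} P \<in> linear_partitions (Suc n) (Suc k) \<longleftrightarrow> P \<in> linear_partitions n k"
proof -
  have "Suc n \<notin> {1..n}" by simp
  note facts = partition_on_insert_singleton[OF this] card_insert_singleton[OF this]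
    in_different_blocks_insert_singleton[OF this] in_different_blocks_singleton_point[OF this]
  have "\<forall>i\<in>{1..n - 1}. in_different_blocks (insert {Suc n} P) i (i + 1)
      \<longleftrightarrow> in_different_blocks P i (i + 1)"
    using facts(3) by auto
  moreover have "in_different_blocks (insert {Suc n} P) n (n + 1)"
    using facts(4)[of P n] assms by simp
  ultimately show ?thesis
    using assms facts(1,2)[of P]
    unfolding linear_partitions_def mem_Collect_eq Ball_less_Suc[OF assms(1)]
      atLeastAtMost_Suc_insert by auto
qed

lemma join_block_in_linear_partitions:
  assumes "1 \<le> n" "partition_on {1..n} P" "X \<in> P"
  shows "join_block (Suc n) P X \<in> linear_partitions (Suc n) k \<longleftrightarrow>
    P \<in> linear_partitions n k \<and> n \<notin> X"
proof -
  have "Suc n \<notin> {1..n}" by simp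
  note facts = partition_on_join_block[OF this] card_join_block[OF this]
    in_different_blocks_join_block[OF this] in_different_blocks_join_block_point[OF this]
  have "\<forall>i\<in>{1..n - 1}. in_different_blocks (join_block (Suc n) P X) i (i + 1)
      \<longleftrightarrow> in_different_blocks P i (i + 1)"
    using facts(3) assms(3) by auto
  moreover have "in_different_blocks (join_block (Suc n) P X) n (n + 1) \<longleftrightarrow> n \<notin> X"
    using facts(4)[of P X n] assms by simp
  ultimately show ?thesis
    using assms facts(1,2)[of P X]
    unfolding linear_partitions_def mem_Collect_eq Ball_less_Suc[OF assms(1)]
      atLeastAtMost_Suc_insert by auto
qed

lemma linear_partitions_Suc_cases:
  assumes "P \<in> linear_partitions (Suc n) k"
  obtains Q where "partition_on {1..n} Q" "P = insert {Suc n} Q"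
  | Q X where "partition_on {1..n} Q" "X \<in> Q" "P = join_block (Suc n) Q X"
proof -
  have "Suc n \<notin> {1..n}" by simp
  moreover have "partition_on (insert (Suc n) {1..n}) P"
    using linear_partitions_partition_on[OF assms] by (simp only: atLeastAtMost_Suc_insert)
  ultimately show thesis
    by (rule partition_on_insert_cases) (fact that)+
qed

text \<open>A new singleton block is always separated from \<open>n\<close>; joining an old block
  \<open>X\<close> is allowed exactly when \<open>n \<notin> X\<close>. The index set pairs each
  partition with its admissible blocks.\<close>

lemma linear_partitions_Suc_Suc:
  assumes "1 \<le> n"
  shows "linear_partitions (Suc n) (Suc k) =
    insert {Suc n} ` linear_partitions n k \<union>
    (\<lambda>(P, X). join_block (Suc n) P X) ` (SIGMA P:linear_partitions n (Suc k). {X \<in> P. n \<notin> X})"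
    (is "_ = ?S \<union> ?J")
proof (intro subset_antisym subsetI)
  fix P assume P: "P \<in> linear_partitions (Suc n) (Suc k)"
  then show "P \<in> ?S \<union> ?J"
  proof (cases rule: linear_partitions_Suc_cases)
    case (1 Q)
    then have "Q \<in> linear_partitions n k"
      using P insert_singleton_in_linear_partitions[OF assms 1(1)] by simp
    then show ?thesis
      using 1(2) by blast
  next
    case (2 Q X)
    then have "(Q, X) \<in> (SIGMA P:linear_partitions n (Suc k). {X \<in> P. n \<notin> X})"
      using P join_block_in_linear_partitions[OF assms 2(1,2)] by simp
    then have "(\<lambda>(P, X). join_block (Suc n) P X) (Q, X) \<in> ?J"
      by (rule imageI)
    then show ?thesis
      using 2(3) by simp
  qed
next
  fix P assume "P \<in> ?S \<union> ?J"
  then consider Q where "Q \<in> linear_partitions n k" "P = insert {Suc n} Q"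
    | Q X where "Q \<in> linear_partitions n (Suc k)" "X \<in> Q" "n \<notin> X" "P = join_block (Suc n) Q X"
    by auto
  then show "P \<in> linear_partitions (Suc n) (Suc k)"
  proof cases
    case 1
    then show ?thesis
      using insert_singleton_in_linear_partitions[OF assms linear_partitions_partition_on] by blast
  next
    case 2
    then show ?thesis
      using join_block_in_linear_partitions[OF assms linear_partitions_partition_on] by blast
  qed
qed

lemma card_linear_partitions_Suc_Suc:
  assumes "1 \<le> n"
  shows "card (linear_partitions (Suc n) (Suc k)) =
    card (linear_partitions n k) + k * card (linear_partitions n (Suc k))"
proof -
  let ?D = "SIGMA P:linear_partitions n (Suc k). {X \<in> P. n \<notin> X}"
  let ?j = "\<lambda>(P, X). join_block (Suc n) P X"
  have new: "Suc n \<notin> {1..n}" by simp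
  have finite_blocks: "finite P" if "P \<in> linear_partitions n l" for P l
    using finite_elements[OF _ linear_partitions_partition_on[OF that]] by simp
  have finD: "finite ?D"
    using finite_linear_partitions finite_blocks by (intro finite_SigmaI) auto
  have "inj_on (insert {Suc n}) (linear_partitions n k)"
    by (rule inj_on_inverseI[of _ "delete_point (Suc n)"])
      (rule delete_point_insert_singleton[OF new linear_partitions_partition_on])
  then have S: "card (insert {Suc n} ` linear_partitions n k) = card (linear_partitions n k)"
    by (rule card_image)
  have "inj_on ?j ?D"
    using join_block_inject[OF new] linear_partitions_partition_on
    by (auto simp: inj_on_def)
  then have "card (?j ` ?D) = card ?D"
    by (rule card_image)
  also have "\<dots> = (\<Sum>P\<in>linear_partitions n (Suc k). card {X \<in> P. n \<notin> X})"
    using finite_linear_partitions finite_blocks by (intro card_SigmaI) auto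
  \<comment> \<open>Of the \<open>Suc k\<close> blocks, exactly one contains
    \<open>n\<close>.\<close>
  also have "\<dots> = (\<Sum>P\<in>linear_partitions n (Suc k). k)"
    using assms by (intro sum.cong) (auto simp: card_blocks_avoiding[of "{1..n}"] linear_partitions_def)
  finally have J: "card (?j ` ?D) = k * card (linear_partitions n (Suc k))"
    by simp
  have "insert {Suc n} ` linear_partitions n k \<inter> ?j ` ?D = {}"
  proof (rule equals0I, elim IntE imageE SigmaE)
    fix R P q Q X
    assume P: "P \<in> linear_partitions n k" and Q: "Q \<in> linear_partitions n (Suc k)"
      and X: "X \<in> {X \<in> Q. n \<notin> X}" and R: "R = insert {Suc n} P" "R = ?j q" "q = (Q, X)"
    from X have "X \<in> Q" by simp
    then have "insert {Suc n} P \<noteq> join_block (Suc n) Q X"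
      using insert_singleton_neq_join_block[OF new] P Q linear_partitions_partition_on by metis
    then show False
      using R(1) unfolding R(2,3) by simp
  qed
  then show ?thesis
    unfolding linear_partitions_Suc_Suc[OF assms] S[symmetric] J[symmetric]
    by (intro card_Un_disjoint finite_imageI finD finite_linear_partitions)
qed

section \<open>Evaluation of the linear counts\<close>

lemma linear_partitions_0_right:
  assumes "1 \<le> n"
  shows "linear_partitions n 0 = {}"
proof -
  have False if P: "partition_on {1..n} P" "card P = 0" for P
  proof -
    have "P = {}"
      using that finite_elements[OF _ P(1)] by simp
    then show False
      using P(1) assms by (auto simp: partition_on_def)
  qed
  then show ?thesis
    by (auto simp: linear_partitions_def)
qed

lemma linear_partitions_1_left:
  "linear_partitions (Suc 0) k = (if k = 1 then {{{1}}} else {})"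
proof -
  have *: "partition_on {1::nat} P \<longleftrightarrow> P = {{1}}" for P
  proof
    assume P: "partition_on {1::nat} P"
    then have "\<forall>X\<in>P. X \<subseteq> {1} \<and> X \<noteq> {}"
      by (auto simp: partition_on_def)
    then have "\<forall>X\<in>P. X = {1}"
      by blast
    moreover have "P \<noteq> {}"
      using P by (auto simp: partition_on_def)
    ultimately show "P = {{1}}" by auto
  qed (auto simp: partition_on_def)
  have "linear_partitions (Suc 0) k = {P. partition_on {1} P \<and> card P = k}"
    by (simp add: linear_partitions_def)
  also have "\<dots> = {P. P = {{1}} \<and> card P = k}"
    by (simp only: *)
  also have "\<dots> = (if k = 1 then {{{1}}} else {})"
    by auto
  finally show ?thesis .
qed

lemma card_linear_partitions_eq_0:
  assumes "1 \<le> n" "n < k"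
  shows "card (linear_partitions n k) = 0"
  using assms
proof (induction n arbitrary: k rule: dec_induct)
  case base
  then show ?case by (simp add: linear_partitions_1_left)
next
  case (step n)
  obtain l where k: "k = Suc l"
    using step.prems by (cases k) auto
  \<comment> \<open>From \<open>Suc n < Suc l\<close> both \<open>l\<close> and \<open>Suc l\<close>
    exceed \<open>n\<close>, so both terms of the recurrence vanish.\<close>
  have "card (linear_partitions n l) = 0" "card (linear_partitions n (Suc l)) = 0"
    using step.prems k by (intro step.IH; simp)+
  then show ?case
    unfolding k card_linear_partitions_Suc_Suc[OF step.hyps(1)] by simp
qed

lemma card_linear_partitions:
  "int (card (linear_partitions (m + Suc k) (Suc k))) = poly (box_poly m k) 0"
\<comment> \<open>Here \<open>m + k\<close> is one less than the number of points. The two terms of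
  the recurrence belong to the parameters \<open>(m, k - 1)\<close> and \<open>(m - 1, k)\<close>,
  whose sums are both smaller by one.\<close>
proof (induction "m + k" arbitrary: m k)
  case 0
  then show ?case by (simp add: linear_partitions_1_left)
next
  case (Suc s)
  have pos: "1 \<le> m + k"
    using Suc.hyps(2) by simp
  have rec: "card (linear_partitions (m + Suc k) (Suc k)) =
      card (linear_partitions (m + k) k) + k * card (linear_partitions (m + k) (Suc k))"
    using card_linear_partitions_Suc_Suc[OF pos] by simp
  show ?case
  proof (cases k)
    case 0
    \<comment> \<open>One block on at least two points: the count is zero, matching
      \<open>0 ^ m\<close> with \<open>m\<close> positive.\<close>
    then show ?thesis
      using rec linear_partitions_0_right[OF pos] pos by simp
  next
    case k: (Suc l)
    have 1: "int (card (linear_partitions (m + k) k)) = poly (box_poly m l) 0"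
      using Suc.hyps(1)[of m l] Suc.hyps(2) k by simp
    show ?thesis
    proof (cases m)
      case 0
      \<comment> \<open>The second term vanishes because \<open>k\<close> points cannot fill
        \<open>Suc k\<close> blocks; the first equals 1, as does the box polynomial with
        \<open>m = 0\<close>.\<close>
      then show ?thesis
        using rec 1 card_linear_partitions_eq_0[OF pos] by simp
    next
      case m: (Suc j)
      have "int (card (linear_partitions (m + k) (Suc k))) = poly (box_poly j k) 0"
        using Suc.hyps(1)[of j k] Suc.hyps(2) m by simp
      then show ?thesis
        using rec 1 by (simp add: m k poly_box_poly_Suc_Suc algebra_simps)
    qed
  qed
qed

section \<open>Passage from linear to cyclic partitions\<close>

text \<open>If \<open>Suc n\<close> shares a block with 1, the block it joins is forced to be that
  of 1, and the requirement that this block avoid \<open>n\<close> says that 1 and \<open>n\<close>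
  are separated.\<close>

lemma card_linear_partitions_joined:
  assumes "1 \<le> n"
  shows "card {P \<in> linear_partitions (Suc n) k. \<not> in_different_blocks P 1 (Suc n)} =
    card (cyclic_partitions n k)"
proof -
  have new: "Suc n \<notin> {1..n}" by simp
  \<comment> \<open>The unique block through 1; joining \<open>Suc n\<close> to it inverts the
    deletion.\<close>
  define b where "b P = (THE X. X \<in> P \<and> 1 \<in> X)" for P :: "nat set set"
  have b: "b P \<in> P" "1 \<in> b P" "\<And>X. X \<in> P \<Longrightarrow> 1 \<in> X \<Longrightarrow> X = b P" if "partition_on {1..n} P" for P
    using partition_on_block_ex1[OF that, of 1] assms theI'[of "\<lambda>X. X \<in> P \<and> 1 \<in> X"]
    unfolding b_def by auto
  let ?J = "{P \<in> linear_partitions (Suc n) k. \<not> in_different_blocks P 1 (Suc n)}"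
  let ?j = "\<lambda>P. join_block (Suc n) P (b P)"
  have J: "\<exists>Q. Q \<in> cyclic_partitions n k \<and> P = ?j Q" if P: "P \<in> ?J" for P
  proof -
    have "P \<in> linear_partitions (Suc n) k" using P by simp
    then show ?thesis
    proof (cases rule: linear_partitions_Suc_cases)
      case (1 Q)
      \<comment> \<open>Impossible case: a singleton \<open>{Suc n}\<close> would separate
        \<open>Suc n\<close> from 1.\<close>
      then show ?thesis
        using P in_different_blocks_singleton_point[OF new] assms by auto
    next
      case (2 Q X)
      then have X: "1 \<in> X"
        using P in_different_blocks_join_block_point[OF new] assms by auto
      then have X_eq: "X = b Q"
        using b(3) 2 by blast
      have Q: "Q \<in> linear_partitions n k" "n \<notin> X"
        using P 2 join_block_in_linear_partitions[OF assms] by auto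
      have "in_different_blocks Q 1 n"
        unfolding in_different_blocks_def using Q(2) X_eq b(3)[OF 2(1)] by blast
      then show ?thesis
        using Q X_eq 2(3) by (auto simp: cyclic_partitions_def)
    qed
  qed
  have C: "partition_on {1..n} Q" if "Q \<in> cyclic_partitions n k" for Q
    using that by (simp add: cyclic_partitions_def linear_partitions_def)
  have del: "delete_point (Suc n) (?j Q) = Q" if "Q \<in> cyclic_partitions n k" for Q
    using delete_point_join_block[OF new C[OF that] b(1)[OF C[OF that]]] .
  have "bij_betw (delete_point (Suc n)) ?J (cyclic_partitions n k)"
  proof (rule bij_betw_byWitness[where f' = ?j])
    show "\<forall>P\<in>?J. ?j (delete_point (Suc n) P) = P"
      using J del by metis
    show "\<forall>Q\<in>cyclic_partitions n k. delete_point (Suc n) (?j Q) = Q"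
      using del by blast
    show "delete_point (Suc n) ` ?J \<subseteq> cyclic_partitions n k"
      using J del by force
    show "?j ` cyclic_partitions n k \<subseteq> ?J"
    proof safe
      fix Q assume Q: "Q \<in> cyclic_partitions n k"
      note bQ = b[OF C[OF Q]]
      have "n \<notin> b Q"
        using Q bQ(1,2) by (auto simp: cyclic_partitions_def in_different_blocks_def)
      then show "?j Q \<in> linear_partitions (Suc n) k"
        using join_block_in_linear_partitions[OF assms C[OF Q] bQ(1)] Q
        by (simp add: cyclic_partitions_def)
      assume "in_different_blocks (?j Q) 1 (Suc n)"
      then show False
        using in_different_blocks_join_block_point[OF new C[OF Q] bQ(1)] bQ(2) assms by simp
    qed
  qed
  then show ?thesis
    by (rule bij_betw_same_card)
qed

lemma card_linear_partitions_eq_cyclic: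
  assumes "1 \<le> n"
  shows "card (linear_partitions (Suc n) k) =
    card (cyclic_partitions (Suc n) k) + card (cyclic_partitions n k)"
proof -
  let ?J = "{P \<in> linear_partitions (Suc n) k. \<not> in_different_blocks P 1 (Suc n)}"
  have "linear_partitions (Suc n) k = cyclic_partitions (Suc n) k \<union> ?J"
    by (auto simp: cyclic_partitions_def)
  moreover have "cyclic_partitions (Suc n) k \<inter> ?J = {}"
    by (auto simp: cyclic_partitions_def)
  moreover have "finite (cyclic_partitions (Suc n) k)" "finite ?J"
    by (simp_all add: cyclic_partitions_def finite_linear_partitions)
  ultimately show ?thesis
    using card_linear_partitions_joined[OF assms] by (metis card_Un_disjoint)
qed

text \<open>Induction on \<open>m\<close> solves the splitting of linear partitions for the cyclic
  count. For \<open>k = 1\<close>, \<open>m = 0\<close> the claim would fail: the count is 0 but the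
  polynomial is 1.\<close>

lemma card_cyclic_partitions:
  assumes "2 \<le> k"
  shows "int (card (cyclic_partitions (m + k) k)) = poly (box_poly m k) (-1)"
proof -
  obtain l where k: "k = Suc l" and l: "1 \<le> l"
    using assms by (cases k) auto
  show ?thesis
  proof (induction m)
    case 0
    \<comment> \<open>There are too few points for \<open>k = Suc l\<close> blocks, so at
      \<open>m = 0\<close> the cyclic and linear counts agree.\<close>
    have "cyclic_partitions l k \<subseteq> linear_partitions l k"
      by (auto simp: cyclic_partitions_def)
    then have "card (cyclic_partitions l k) = 0"
      using card_linear_partitions_eq_0[OF l, of k] finite_linear_partitions[of l k] k by auto
    then show ?case
      using card_linear_partitions_eq_cyclic[OF l, of k] card_linear_partitions[of 0 l] k by simp
  next
    case (Suc m)
    have "int (card (cyclic_partitions (Suc m + k) k)) =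
        int (card (linear_partitions (Suc m + k) k)) - int (card (cyclic_partitions (m + k) k))"
      using card_linear_partitions_eq_cyclic[of "m + k" k] k by simp
    also have "\<dots> = poly (box_poly (Suc m) l) 0 - poly (box_poly m k) (-1)"
      using card_linear_partitions[of "Suc m" l] Suc k by simp
    \<comment> \<open>The shifted recurrence at \<open>x = -1\<close>: the factor \<open>x\<close>
      supplies the minus sign, and \<open>x + 1 = 0\<close> is where the linear count is
      evaluated.\<close>
    also have "\<dots> = poly (box_poly (Suc m) k) (-1)"
      by (simp add: k poly_box_poly_Suc_Suc_shift)
    finally show ?case .
  qed
qed

theorem proposition3p2:
  fixes n k :: nat
  assumes "2 \<le> k" and "k \<le> n"
  shows "int (card {P. partition_on {1..n} P \<and> card P = k \<and>
             (\<forall>i\<in>{1..n - 1}. in_different_blocks P i (i + 1)) \<and>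
             in_different_blocks P 1 n})
         = poly (box_poly (n - k) k) (-1)"
  \<comment> \<open>Since \<open>k \<le> n\<close>, the truncated difference satisfies
    \<open>n - k + k = n\<close>.\<close>
  using card_cyclic_partitions[OF assms(1), of "n - k"] assms(2)
  by (simp add: cyclic_partitions_def linear_partitions_def conj_assoc)

end
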